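(* Let $E$ and $F$ be real Banach spaces, let $0<\varepsilon<0.2$ and $L\ge 0$, and let $T:E\to F$ be a $\mu$-isometry for $\mu(t)=(1+\varepsilon)t+L$. Then for all $a,b\in E$, $$\left\|T\left(\frac{a+b}{2}\right)-\frac{Ta+Tb}{2}\right\|\le 3\varepsilon\|a-b\|+\frac{4}{\varepsilon}L.$$
   Context: $\mathbb{R}_+=\{x\in\mathbb{R}:x\ge 0\}$. For a non-decreasing function $\mu:\mathbb{R}_+\to\mathbb{R}_+$, a map $T:E\to F$ between Banach spaces is called a $\mu$-isometry if $T$ is a bijection, $\|Tx-Ty\|\le\mu(\|x-y\|)$ for all $x,y\in E$, and $\|T^{-1}f-T^{-1}g\|\le\mu(\|f-g\|)$ for all $f,g\in F$. No continuity or linearity of $T$ is assumed. *)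

theory Defs
  imports "HOL-Analysis.Analysis"
begin

(* A non-decreasing map from [0,\<infinity>) to [0,\<infinity>) is represented by a total function on the reals
   constrained on {0..} only; its values at negative arguments are never used. *)
definition mu_isometry :: "(real \<Rightarrow> real) \<Rightarrow> ('a::banach \<Rightarrow> 'b::banach) \<Rightarrow> bool" where
  "mu_isometry \<mu> T \<longleftrightarrow>
     \<mu> \<in> {0..} \<rightarrow> {0..} \<and> mono_on {0..} \<mu> \<and>
     bij T \<and>
     (\<forall>x y. norm (T x - T y) \<le> \<mu> (norm (x - y))) \<and>
     (\<forall>f g. norm (inv T f - inv T g) \<le> \<mu> (norm (f - g)))"

end

theory Submission
  imports Defs
begin

text \<open>
  Reflecting both in the domain and in the range turns \<open>T\<close> into the self-map
  \<open>S x = a + b - T\<inverse> (T a + T b - T x)\<close>, which fixes \<open>a\<close> and \<open>b\<close>. It moves the midpoint about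
  twice as far as \<open>T\<close> displaces it from \<open>(T a + T b) / 2\<close>, at the price of squaring the
  multiplicative constant \<open>1 + \<epsilon>\<close>. After \<open>n\<close> such steps the displacement is still controlled by
  the trivial bound, so the original one is at most about
  \<open>exp (2\<^sup>n * 2 * \<epsilon>) / (2\<^sup>n * 2) * norm (a - b)\<close>. Choosing \<open>n\<close> such that
  \<open>x = 2\<^sup>n * 2 * \<epsilon>\<close> lies between 0.7 and 1.4, where \<open>exp x \<le> 3 * x\<close>, gives the constant 3.
\<close>

text \<open>The additive constant is written as \<open>(K - 1) * p\<close> because the map \<open>t \<mapsto> K * t + (K - 1) * p\<close>
  fixes \<open>-p\<close>, so composing two such moduli multiplies the \<open>K\<close>'s and keeps \<open>p\<close>.\<close>
definition near_isometry :: "real \<Rightarrow> real \<Rightarrow> ('a::real_normed_vector \<Rightarrow> 'b::real_normed_vector) \<Rightarrow> bool" where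
  "near_isometry K p T \<longleftrightarrow> bij T \<and>
     (\<forall>x y. norm (T x - T y) \<le> K * norm (x - y) + (K - 1) * p) \<and>
     (\<forall>f g. norm (inv T f - inv T g) \<le> K * norm (f - g) + (K - 1) * p)"

definition midpoint_defect :: "('a::real_normed_vector \<Rightarrow> 'b::real_normed_vector) \<Rightarrow> 'a \<Rightarrow> 'a \<Rightarrow> real" where
  "midpoint_defect T a b = norm (T ((a + b) /\<^sub>R 2) - (T a + T b) /\<^sub>R 2)"

definition reflected :: "('a::real_normed_vector \<Rightarrow> 'b::real_normed_vector) \<Rightarrow> 'a \<Rightarrow> 'a \<Rightarrow> 'a \<Rightarrow> 'a" where
  "reflected T a b x = a + b - inv T (T a + T b - T x)"

lemma inv_reflected:
  assumes "bij T"
  shows "bij (reflected T a b)"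
    and "inv (reflected T a b) y = inv T (T a + T b - T (a + b - y))"
proof -
  let ?g = "\<lambda>y. inv T (T a + T b - T (a + b - y))"
  have l: "?g (reflected T a b x) = x" for x
    using assms by (simp add: reflected_def bij_is_surj surj_f_inv_f bij_is_inj)
  have r: "reflected T a b (?g y) = y" for y
    using assms by (simp add: reflected_def bij_is_surj surj_f_inv_f bij_is_inj)
  show "bij (reflected T a b)"
    using l r by (intro o_bij[where g = ?g]) (auto simp: fun_eq_iff)
  then show "inv (reflected T a b) y = ?g y"
    using r by (metis bij_inv_eq_iff)
qed

text \<open>Point reflections are isometries, so this map and its inverse each use \<open>T\<close>
  once and \<open>inv T\<close> once; the modulus is composed with itself.\<close>

lemma near_isometry_reflected:
  assumes T: "near_isometry K p T" and K: "1 \<le> K"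
  shows "near_isometry (K\<^sup>2) p (reflected T a b)"
proof -
  have bij: "bij T"
    and fwd: "norm (T x - T y) \<le> K * norm (x - y) + (K - 1) * p"
    and bwd: "norm (inv T f - inv T g) \<le> K * norm (f - g) + (K - 1) * p" for x y f g
    using T by (auto simp: near_isometry_def)
  have comp: "norm (inv T (c - T x) - inv T (c - T y)) \<le> K\<^sup>2 * norm (x - y) + (K\<^sup>2 - 1) * p" for c x y
  proof -
    have "norm (inv T (c - T x) - inv T (c - T y)) \<le> K * norm (T x - T y) + (K - 1) * p"
      using bwd[of "c - T x" "c - T y"] by (simp add: norm_minus_commute)
    also have "\<dots> \<le> K * (K * norm (x - y) + (K - 1) * p) + (K - 1) * p"
      using fwd[of x y] K by (intro add_right_mono mult_left_mono) auto
    finally show ?thesis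
      by (simp add: algebra_simps power2_eq_square)
  qed
  show ?thesis
    unfolding near_isometry_def
  proof (intro conjI allI)
    show "bij (reflected T a b)"
      by (rule inv_reflected(1)[OF bij])
    show "norm (reflected T a b x - reflected T a b y) \<le> K\<^sup>2 * norm (x - y) + (K\<^sup>2 - 1) * p" for x y
      using comp[of "T a + T b" x y] by (simp add: reflected_def norm_minus_commute)
    show "norm (inv (reflected T a b) f - inv (reflected T a b) g) \<le> K\<^sup>2 * norm (f - g) + (K\<^sup>2 - 1) * p" for f g
      using comp[of "T a + T b" "a + b - f" "a + b - g"]
      by (simp add: inv_reflected(2)[OF bij] norm_minus_commute)
  qed
qed

text \<open>Let \<open>z\<close> be the midpoint and \<open>v\<close> the preimage of the reflection
  of \<open>T z\<close>. Then \<open>T z - T v\<close> is twice the displacement of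
  \<open>T z\<close>, while \<open>reflected T a b\<close> fixes \<open>a\<close> and
  \<open>b\<close> and moves \<open>z\<close> by \<open>z - v\<close>. The forward bound for
  \<open>T\<close> at \<open>z\<close>, \<open>v\<close> links the two.\<close>

lemma midpoint_defect_reflected:
  assumes T: "near_isometry K p T"
  shows "midpoint_defect T a b \<le> (K * midpoint_defect (reflected T a b) a b + (K - 1) * p) / 2"
proof -
  have bij: "bij T"
    and fwd: "norm (T x - T y) \<le> K * norm (x - y) + (K - 1) * p" for x y
    using T by (auto simp: near_isometry_def)
  define z where "z = (a + b) /\<^sub>R 2"
  define v where "v = inv T (T a + T b - T z)"
  have ab: "a + b = z + z"
    unfolding z_def by (simp flip: scaleR_2)
  have "reflected T a b a = a" "reflected T a b b = b"
    using bij by (simp_all add: reflected_def bij_is_inj)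
  then have S: "midpoint_defect (reflected T a b) a b = norm (z - v)"
    unfolding midpoint_defect_def z_def[symmetric] by (simp add: reflected_def v_def ab z_def[symmetric])
  have "T v = T a + T b - T z"
    using bij by (simp add: v_def bij_is_surj surj_f_inv_f)
  then have "T z - T v = 2 *\<^sub>R (T z - (T a + T b) /\<^sub>R 2)"
    by (simp add: algebra_simps scaleR_2)
  then have "norm (T z - T v) = 2 * midpoint_defect T a b"
    by (simp add: midpoint_defect_def z_def)
  with fwd[of z v] show ?thesis
    by (simp add: S)
qed

lemma midpoint_defect_trivial:
  assumes T: "near_isometry K p T"
  shows "midpoint_defect T a b \<le> K / 2 * norm (a - b) + (K - 1) * p"
proof -
  have fwd: "norm (T x - T y) \<le> K * norm (x - y) + (K - 1) * p" for x y
    using T by (auto simp: near_isometry_def)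
  define z where "z = (a + b) /\<^sub>R 2"
  have za: "z - a = (b - a) /\<^sub>R 2" and zb: "z - b = (a - b) /\<^sub>R 2"
    using scaleR_half_double[of a] scaleR_half_double[of b]
    by (simp_all add: z_def algebra_simps)
  have "T z - (T a + T b) /\<^sub>R 2 = ((T z - T a) + (T z - T b)) /\<^sub>R 2"
    using scaleR_half_double[of "T z"] by (simp add: algebra_simps)
  then have "midpoint_defect T a b = norm ((T z - T a) + (T z - T b)) / 2"
    by (simp add: midpoint_defect_def z_def)
  also have "\<dots> \<le> (norm (T z - T a) + norm (T z - T b)) / 2"
    by (simp add: norm_triangle_ineq)
  also have "\<dots> \<le> K / 2 * norm (a - b) + (K - 1) * p"
    using fwd[of z a] fwd[of z b] by (simp add: za zb norm_minus_commute)
  finally show ?thesis .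
qed

text \<open>The exponent is \<open>1 + 2 + ... + 2 ^ n\<close>: the reflections contribute
  \<open>K\<close>, \<open>K\<^sup>2\<close>, \<open>K ^ 4\<close> and so on, and the trivial bound
  contributes the last factor. Self-maps are required because the induction hypothesis is applied to
  \<open>reflected T a b\<close>.\<close>

lemma midpoint_defect_iterated:
  fixes T :: "'a::real_normed_vector \<Rightarrow> 'a"
  assumes "near_isometry K p T" "1 \<le> K" "0 \<le> p" "K ^ 2 ^ n \<le> 21/10"
  shows "midpoint_defect T a b \<le> K ^ (2 ^ Suc n - 1) / 2 ^ Suc n * norm (a - b) + 11/10 * p"
  using assms
proof (induction n arbitrary: K T)
  case 0
  then have "(K - 1) * p \<le> 11/10 * p"
    by (intro mult_right_mono) auto
  with midpoint_defect_trivial[OF 0(1), of a b] show ?case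
    by simp
next
  case (Suc n)
  let ?d = "norm (a - b)" and ?m = "2 ^ Suc n :: nat"
  have "(K\<^sup>2) ^ 2 ^ n \<le> 21/10"
    using Suc.prems by (simp flip: power_mult)
  then have "midpoint_defect (reflected T a b) a b \<le> (K\<^sup>2) ^ (?m - 1) / 2 ^ Suc n * ?d + 11/10 * p"
    using Suc.prems by (intro Suc.IH near_isometry_reflected) auto
  then have "K * midpoint_defect (reflected T a b) a b
      \<le> K * ((K\<^sup>2) ^ (?m - 1) / 2 ^ Suc n * ?d + 11/10 * p)"
    using Suc.prems by (intro mult_left_mono) auto
  also have "\<dots> = (K * (K\<^sup>2) ^ (?m - 1)) / 2 ^ Suc n * ?d + 11/10 * K * p"
    by (simp add: algebra_simps)
  also have "K * (K\<^sup>2) ^ (?m - 1) = K ^ (2 * ?m - 1)"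
  proof -
    have "1 \<le> ?m"
      by (rule one_le_power) simp
    then have "2 * ?m - 1 = Suc (2 * (?m - 1))"
      by linarith
    then show ?thesis
      by (simp only: power_Suc power_mult)
  qed
  finally have S: "K * midpoint_defect (reflected T a b) a b
      \<le> K ^ (2 ^ Suc (Suc n) - 1) / 2 ^ Suc n * ?d + 11/10 * K * p"
    by simp
  \<comment> \<open>The additive term reproduces itself if
    \<open>11/10 * K + (K - 1) \<le> 22/10\<close>, for which \<open>K \<le> 3/2\<close> suffices;
    this follows from \<open>21/10 \<le> 9/4\<close>.\<close>
  have "K\<^sup>2 \<le> K ^ 2 ^ Suc n"
    using Suc.prems by (intro power_increasing) auto
  then have "K\<^sup>2 \<le> (3/2)\<^sup>2"
    using Suc.prems by (simp add: power2_eq_square)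
  then have "K \<le> 3/2"
    by (rule power2_le_imp_le) simp
  then have "(21/10 * K) * p \<le> (32/10) * p"
    using Suc.prems by (intro mult_right_mono) auto
  then have "11/10 * K * p + (K - 1) * p \<le> 22/10 * p"
    by (simp add: algebra_simps)
  with S midpoint_defect_reflected[OF Suc.prems(1), of a b] show ?case
    by simp
qed

text \<open>The estimate \<open>exp t \<le> 1 + t + t\<^sup>2\<close> is sharp enough only for small
  \<open>t\<close>; it is used at \<open>1/20\<close> and raised to powers.\<close>

lemma exp_bounds: "exp (7/10 :: real) \<le> 21/10" "exp (7/5 :: real) \<le> 42/10"
proof -
  have e: "exp (1/20 :: real) \<le> 421/400"
    using exp_bound[of "1/20 :: real"] by (simp add: power2_eq_square)
  have "exp (7/10 :: real) = exp (1/20) ^ 14" "exp (7/5 :: real) = exp (1/20) ^ 28"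
    by (simp_all flip: exp_of_nat_mult)
  moreover have "exp (1/20 :: real) ^ 14 \<le> (421/400) ^ 14" "exp (1/20 :: real) ^ 28 \<le> (421/400) ^ 28"
    using e by (intro power_mono; simp)+
  moreover have "(421/400 :: real) ^ 14 \<le> 21/10" "(421/400 :: real) ^ 28 \<le> 42/10"
    by (simp_all add: power_divide)
  ultimately show "exp (7/10 :: real) \<le> 21/10" "exp (7/5 :: real) \<le> 42/10"
    by linarith+
qed

text \<open>By convexity \<open>exp\<close> lies below its chord, and at both endpoints the chord
  lies below the line \<open>3 * x\<close>.\<close>

lemma exp_le_3_times:
  fixes x :: real
  assumes "7/10 \<le> x" "x \<le> 7/5"
  shows "exp x \<le> 3 * x"
proof -
  have "exp x \<le> (exp (7/5) - exp (7/10)) / (7/5 - 7/10) * (x - 7/10) + exp (7/10 :: real)"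
    using assms by (intro convex_onD_Icc'[OF convex_on_subset[OF exp_convex]]) auto
  also have "\<dots> = exp (7/5) * (x / (7/10) - 1) + exp (7/10) * (2 - x / (7/10))"
    by (simp add: field_simps)
  also have "\<dots> \<le> 42/10 * (x / (7/10) - 1) + 21/10 * (2 - x / (7/10))"
    using assms exp_bounds by (intro add_mono mult_right_mono) auto
  also have "\<dots> = 3 * x"
    by (simp add: field_simps)
  finally show ?thesis .
qed

theorem corollary3p3:
  fixes T :: "'a::banach \<Rightarrow> 'b::banach" and \<epsilon> L :: real
  assumes "0 < \<epsilon>" and "\<epsilon> < 0.2" and "L \<ge> 0"
    and "mu_isometry (\<lambda>t. (1 + \<epsilon>) * t + L) T"
  shows "\<forall>a b. norm (T ((a + b) /\<^sub>R 2) - (T a + T b) /\<^sub>R 2)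
           \<le> 3 * \<epsilon> * norm (a - b) + 4 / \<epsilon> * L"
proof (intro allI)
  fix a b :: 'a
  define K where "K = 1 + \<epsilon>"
  define p where "p = L / \<epsilon>"
  have K: "1 \<le> K" and p: "0 \<le> p" and L: "L = (K - 1) * p"
    using assms by (auto simp: K_def p_def)
  have T: "near_isometry K p T"
    using assms(4) L by (simp add: near_isometry_def mu_isometry_def K_def)
  \<comment> \<open>The first doubling of \<open>2 * \<epsilon>\<close> to reach 7/10 stays below
    7/5. It is not the zeroth, as \<open>2 * \<epsilon> < 0.4\<close>.\<close>
  define P where "P n \<longleftrightarrow> 7/10 \<le> 2 ^ n * (2 * \<epsilon>)" for n :: nat
  obtain m :: nat where "7/10 / (2 * \<epsilon>) < 2 ^ m"
    using real_arch_pow[of 2 "7/10 / (2 * \<epsilon>)"] by auto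
  then have "P m"
    using assms by (simp add: P_def field_simps)
  moreover have "\<not> P 0"
    using assms by (simp add: P_def)
  ultimately obtain n where n: "\<not> P n" "P (Suc n)"
    using ex_least_nat_less[of P m] by auto
  define x where "x = 2 ^ Suc n * (2 * \<epsilon>)"
  have x: "7/10 \<le> x" "x \<le> 7/5"
    using n by (auto simp: P_def x_def)
  have K_le: "K ^ j \<le> exp (real j * \<epsilon>)" for j
    using exp_ge_add_one_self[of \<epsilon>] assms
    by (auto simp: exp_of_nat_mult K_def intro!: power_mono)
  have "(K\<^sup>2) ^ 2 ^ n = K ^ 2 ^ Suc n"
    by (simp flip: power_mult)
  also have "\<dots> \<le> exp (x / 2)"
    using K_le[of "2 ^ Suc n"] by (simp add: x_def mult_ac)
  also have "\<dots> \<le> exp (7/10)"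
    using x by simp
  finally have "(K\<^sup>2) ^ 2 ^ n \<le> 21/10"
    using exp_bounds by simp
  then have S: "midpoint_defect (reflected T a b) a b
      \<le> (K\<^sup>2) ^ (2 ^ Suc n - 1) / 2 ^ Suc n * norm (a - b) + 11/10 * p"
    using K p by (intro midpoint_defect_iterated near_isometry_reflected T) auto
  \<comment> \<open>Rounding the factor \<open>K\<close> of the first reflection up to
    \<open>K\<^sup>2\<close> completes the exponent to \<open>2 * 2 ^ Suc n\<close>, which matches
    \<open>x\<close>.\<close>
  have "K * (K\<^sup>2) ^ (2 ^ Suc n - 1) \<le> K\<^sup>2 * (K\<^sup>2) ^ (2 ^ Suc n - 1)"
    using K by (intro mult_right_mono) (auto simp: power2_eq_square)
  also have "\<dots> = (K\<^sup>2) ^ Suc (2 ^ Suc n - 1)"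
    by (simp only: power_Suc)
  also have "Suc (2 ^ Suc n - 1) = 2 ^ Suc n"
    by simp
  also have "(K\<^sup>2) ^ 2 ^ Suc n = K ^ (2 * 2 ^ Suc n)"
    by (simp only: power_mult)
  also have "\<dots> \<le> exp x"
    using K_le[of "2 * 2 ^ Suc n"] by (simp add: x_def algebra_simps)
  also have "\<dots> \<le> 3 * x"
    using x by (rule exp_le_3_times)
  finally have "K * (K\<^sup>2) ^ (2 ^ Suc n - 1) / 2 ^ Suc n \<le> 6 * \<epsilon>"
    by (simp add: x_def field_simps)
  then have lin: "K * (K\<^sup>2) ^ (2 ^ Suc n - 1) / 2 ^ Suc n * norm (a - b) \<le> 6 * \<epsilon> * norm (a - b)"
    by (rule mult_right_mono) simp
  \<comment> \<open>There is ample room: \<open>K < 1.2\<close> puts the left side below 2, and 8 is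
    just twice the constant 4 of the claim.\<close>
  have "K * (11/10) + (K - 1) \<le> 8"
    using assms by (simp add: K_def field_simps)
  then have add: "(K * (11/10) + (K - 1)) * p \<le> 8 * p"
    using p by (rule mult_right_mono)
  have "2 * midpoint_defect T a b \<le> K * midpoint_defect (reflected T a b) a b + (K - 1) * p"
    using midpoint_defect_reflected[OF T, of a b] by simp
  also have "\<dots> \<le> K * ((K\<^sup>2) ^ (2 ^ Suc n - 1) / 2 ^ Suc n * norm (a - b) + 11/10 * p) + (K - 1) * p"
    using S K by (intro add_right_mono mult_left_mono) auto
  also have "\<dots> = K * (K\<^sup>2) ^ (2 ^ Suc n - 1) / 2 ^ Suc n * norm (a - b) + (K * (11/10) + (K - 1)) * p"
    by (simp add: algebra_simps)
  also have "\<dots> \<le> 6 * \<epsilon> * norm (a - b) + 8 * p"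
    using lin add by (rule add_mono)
  finally show "norm (T ((a + b) /\<^sub>R 2) - (T a + T b) /\<^sub>R 2)
      \<le> 3 * \<epsilon> * norm (a - b) + 4 / \<epsilon> * L"
    by (simp add: midpoint_defect_def p_def)
qed

end
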